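(* Let the velocity functions satisfy $v_s(\rho)=k_s\psi(\rho)$, $s=l,r$, with $\psi\in C^2(\mathbb{R})$ and $\psi'\le 0$. Given an initial datum such that $0\le\rho_j^0\le\rho_{\max}$ for $j\in\mathbb{Z}$, the finite volume scheme described in the context is such that $$0\le\rho_j^{n+1}\le\rho_{\max},\qquad j\in\mathbb{Z},\quad n=0,1,\dots$$ under the CFL condition $$\Delta t\le\min_{s=l,r}\left\{\frac{\Delta x}{\rho_{\max}k_s\|g'\|_{L^\infty}\|\psi\|_{L^\infty}},\ \frac{\Delta x}{k_s\|g\|_{L^\infty}\|\psi\|_{L^\infty}}\right\}.$$
   Context: The scheme approximates the non-local conservation law $\partial_t\rho+\partial_x f(t,x,\rho)=0$, $\rho(0,x)=\rho_0(x)$, on $(0,\infty)\times\mathbb{R}$, with $f(t,x,\rho)=H(-x)\,\rho\, g(\rho)\,v_l(\omega_\eta*\rho)+H(x)\,\rho\, g(\rho)\,v_r(\omega_\eta*\rho)$, where $H$ is the Heaviside function and $(\omega_\eta*\rho)(t,x)=\int_x^{x+\eta}\rho(t,y)\,\omega_\eta(y-x)\,dy$, $\eta>0$. Here $\rho_{\max}$ is the maximal density; $g$ is positive with $g'\le0$ and $g(\rho_{\max})=0$; $k_l,k_r$ are the constants appearing in the velocities $v_l,v_r$; the kernel satisfies $\omega_\eta\in C^2([0,\eta];\mathbb{R}^+)$, $\omega_\eta'\le0$, $\omega_\eta(\eta)=0$. Scheme: $\Delta x$ is the space mesh width, with $\eta=N\Delta x$ for some $N\in\mathbb{N}$; $\Delta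 t$ is the time step, $\lambda=\Delta t/\Delta x$, $t^n=n\Delta t$, $x_j=j\Delta x$, $x_{j+1/2}=x_j+\Delta x/2$ (so $x=0$ is the midpoint of the cell $[x_{-1/2},x_{1/2})$). The initial values are the cell averages $\rho_j^0=\frac1{\Delta x}\int_{x_{j-1/2}}^{x_{j+1/2}}\rho_0(x)\,dx$. Put $\omega_k=\frac1{\Delta x}\int_{k\Delta x}^{(k+1)\Delta x}\omega_\eta(y)\,dy$ for $k=0,\dots,N-1$ and $R^n_{j+1/2}=\Delta x\sum_{k=0}^{N-1}\omega_k\rho^n_{j+k+1}$. Let $v^n_{j+1/2}=v_l(R^n_{j+1/2})$ if $x_{j+1/2}<0$ and $v^n_{j+1/2}=v_r(R^n_{j+1/2})$ if $x_{j+1/2}>0$. The scheme is $$\rho_j^{n+1}=\rho_j^n-\lambda\left(\rho_j^n g(\rho_{j+1}^n)v^n_{j+1/2}-\rho_{j-1}^n g(\rho_j^n)v^n_{j-1/2}\right),\qquad j\in\mathbb{Z}.$$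
   Formalization: The function ψ is additionally assumed non-negative on [0, ρ_max∫ω_η], the interval where the velocities are evaluated; without this the claim fails (e.g. ψ = −1 with ρ_j=0, ρ_{j−1}>0 gives a negative density). The identically zero kernel is excluded. *)

theory Defs
  imports "HOL-Probability.Essential_Supremum"
begin

text \<open>Derivative relative to a set: one-sided at the end points of a closed interval.\<close>

definition deriv_on :: "real set \<Rightarrow> (real \<Rightarrow> real) \<Rightarrow> real \<Rightarrow> real" where
  "deriv_on S f x = vector_derivative f (at x within S)"

definition C2_on :: "real set \<Rightarrow> (real \<Rightarrow> real) \<Rightarrow> bool" where
  "C2_on S f \<longleftrightarrow> f differentiable_on S \<and> deriv_on S f differentiable_on S \<and>
     continuous_on S (deriv_on S (deriv_on S f))"

text \<open>The \<open>L\<^sup>\<infinity>\<close> norm is extended-real valued, so that it is \<open>\<infinity>\<close> for an essentially unbounded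
  function. On a null set \<open>S\<close> the essential supremum is \<open>-\<infinity>\<close>.\<close>

definition Linf_norm :: "real set \<Rightarrow> (real \<Rightarrow> real) \<Rightarrow> ereal" where
  "Linf_norm S f = esssup (lebesgue_on S) (\<lambda>x. ereal \<bar>f x\<bar>)"

text \<open>The values that \<open>\<integral>\<^bsub>x\<^esub>\<^bsup>x+\<eta>\<^esup> \<rho>(y) \<omega>(y - x) dy\<close> can take for densities \<open>\<rho>\<close> in
  \<open>[0, \<rho>\<^sub>m\<^sub>a\<^sub>x]\<close>; this is \<open>[0, \<rho>\<^sub>m\<^sub>a\<^sub>x]\<close> itself if the kernel has unit mass. Velocities are
  only ever evaluated on this interval.\<close>

definition nonlocal_range :: "real \<Rightarrow> real \<Rightarrow> (real \<Rightarrow> real) \<Rightarrow> real set" where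
  "nonlocal_range \<rho>max \<eta> \<omega> = {0..\<rho>max * (LBINT y:{0..\<eta>}. \<omega> y)}"

text \<open>Mesh points: \<open>node \<Delta>x j\<close> is the cell centre \<open>x\<^sub>j\<close>, and \<open>face \<Delta>x j\<close> is the interface
  \<open>x\<close> with index \<open>j + 1/2\<close>. All half-integer quantities below are indexed in the same way by
  the integer to their left; in particular index \<open>j - 1\<close> stands for \<open>j - 1/2\<close>. The
  position of a face is never \<open>0\<close> when \<open>\<Delta>x > 0\<close>.\<close>

definition node :: "real \<Rightarrow> int \<Rightarrow> real" where
  "node \<Delta>x j = of_int j * \<Delta>x"

definition face :: "real \<Rightarrow> int \<Rightarrow> real" where
  "face \<Delta>x j = node \<Delta>x j + \<Delta>x / 2"

definition cell_average :: "real \<Rightarrow> (real \<Rightarrow> real) \<Rightarrow> int \<Rightarrow> real" where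
  "cell_average \<Delta>x \<rho>0 j = (1 / \<Delta>x) * (LBINT x:{face \<Delta>x (j - 1)..face \<Delta>x j}. \<rho>0 x)"

definition kernel_weight :: "real \<Rightarrow> (real \<Rightarrow> real) \<Rightarrow> nat \<Rightarrow> real" where
  "kernel_weight \<Delta>x \<omega> k =
     (1 / \<Delta>x) * (LBINT y:{real k * \<Delta>x..(real k + 1) * \<Delta>x}. \<omega> y)"

definition nonlocal_density ::
    "real \<Rightarrow> nat \<Rightarrow> (real \<Rightarrow> real) \<Rightarrow> (int \<Rightarrow> real) \<Rightarrow> int \<Rightarrow> real" where
  "nonlocal_density \<Delta>x N \<omega> r j = \<Delta>x * (\<Sum>k<N. kernel_weight \<Delta>x \<omega> k * r (j + int k + 1))"

definition face_velocity ::
    "real \<Rightarrow> nat \<Rightarrow> (real \<Rightarrow> real) \<Rightarrow> (real \<Rightarrow> real) \<Rightarrow> (real \<Rightarrow> real) \<Rightarrow> (int \<Rightarrow> real) \<Rightarrow> int \<Rightarrow> real"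
  where
  "face_velocity \<Delta>x N \<omega> vl vr r j =
     (if face \<Delta>x j < 0 then vl (nonlocal_density \<Delta>x N \<omega> r j)
      else vr (nonlocal_density \<Delta>x N \<omega> r j))"

definition scheme_step ::
    "real \<Rightarrow> real \<Rightarrow> nat \<Rightarrow> (real \<Rightarrow> real) \<Rightarrow> (real \<Rightarrow> real) \<Rightarrow> (real \<Rightarrow> real) \<Rightarrow> (real \<Rightarrow> real) \<Rightarrow>
     (int \<Rightarrow> real) \<Rightarrow> int \<Rightarrow> real" where
  "scheme_step \<Delta>t \<Delta>x N \<omega> g vl vr r j =
     r j - (\<Delta>t / \<Delta>x) *
       (r j * g (r (j + 1)) * face_velocity \<Delta>x N \<omega> vl vr r j
        - r (j - 1) * g (r j) * face_velocity \<Delta>x N \<omega> vl vr r (j - 1))"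

end

theory Submission
  imports Defs
begin

text \<open>Both bounds are propagated from one time level to the next. Dropping the incoming flux,
  \<open>\<rho>\<^sub>j\<close> is multiplied by a factor that is nonnegative by the second CFL bound. Dropping the outgoing
  flux and estimating \<open>\<rho>\<^sub>j\<^sub>-\<^sub>1 \<le> \<rho>\<^sub>m\<^sub>a\<^sub>x\<close> and
  \<open>g(\<rho>\<^sub>j) = g(\<rho>\<^sub>j) - g(\<rho>\<^sub>m\<^sub>a\<^sub>x) \<le> \<parallel>g'\<parallel> (\<rho>\<^sub>m\<^sub>a\<^sub>x - \<rho>\<^sub>j)\<close>, the first CFL bound shows that the increment is
  at most \<open>\<rho>\<^sub>m\<^sub>a\<^sub>x - \<rho>\<^sub>j\<close>. The norms are essential suprema, so pointwise bounds need an argument: for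
  \<open>g\<close> and \<open>\<psi>\<close> it is continuity, and for \<open>g'\<close>, which need not be continuous, it is the fundamental
  theorem of calculus for the Henstock--Kurzweil integral.\<close>

section \<open>Pointwise consequences of essential-supremum bounds\<close>

lemma Linf_norm_le_imp_AE:
  assumes "S \<in> sets lebesgue" "Linf_norm S f \<le> ereal z"
  shows "AE x \<in> S in lebesgue. \<bar>f x\<bar> \<le> z"
proof -
  have "AE x in lebesgue_on S. ereal \<bar>f x\<bar> \<le> Linf_norm S f"
    unfolding Linf_norm_def by (rule esssup_AE)
  then have "AE x in lebesgue_on S. \<bar>f x\<bar> \<le> z"
    by (rule eventually_mono) (use assms(2) order_trans in fastforce)
  then show ?thesis
    using assms(1) by (simp add: AE_restrict_space_iff)
qed

text \<open>By continuity the points with \<open>\<bar>f x\<bar> \<le> z\<close> form a closed set,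
  so the remaining points of the open interval form an open null set, which is empty. The end points
  follow by passing to the closure, which is where \<open>a < b\<close> enters.\<close>

lemma abs_le_Linf_norm:
  assumes "a < b" "continuous_on {a..b} f" "x \<in> {a..b}"
  shows "ereal \<bar>f x\<bar> \<le> Linf_norm {a..b} f"
proof (rule ereal_le_real)
  fix z
  assume "Linf_norm {a..b} f \<le> ereal z"
  then have "AE x \<in> {a..b} in lebesgue. \<bar>f x\<bar> \<le> z"
    by (intro Linf_norm_le_imp_AE) auto
  then have ae: "AE x \<in> {a<..<b} in lebesgue. x \<in> {x \<in> {a..b}. \<bar>f x\<bar> \<le> z}"
    by (rule eventually_mono) auto
  have cont: "continuous_on {a..b} (\<lambda>x. \<bar>f x\<bar>)"
    using assms(2) by (intro continuous_intros)
  have "closed {x \<in> {a..b}. \<bar>f x\<bar> \<le> z}"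
    using cont by (intro continuous_on_closed_Collect_le continuous_on_const) auto
  then have "\<And>x. x \<in> {a<..<b} \<Longrightarrow> \<bar>f x\<bar> \<le> z"
    using mem_closed_if_AE_lebesgue_open[OF open_greaterThanLessThan _ ae] by simp
  then have "\<bar>f x\<bar> \<le> z"
    using continuous_le_on_closure[of "{a<..<b}" "\<lambda>x. \<bar>f x\<bar>" x z] cont assms(1,3) by simp
  then show "ereal \<bar>f x\<bar> \<le> ereal z"
    by simp
qed

text \<open>The quotient is the average of minus the derivative over \<open>{x..y}\<close>, so every
  essential bound \<open>z\<close> of the derivative bounds it as well.\<close>

lemma difference_quotient_le_Linf_norm_deriv:
  assumes "f differentiable_on {a..b}" "a \<le> x" "x < y" "y \<le> b"
  shows "ereal ((f x - f y) / (y - x)) \<le> Linf_norm {a..b} (deriv_on {a..b} f)"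
proof (rule ereal_le_real)
  fix z
  let ?f' = "deriv_on {a..b} f"
  assume "Linf_norm {a..b} ?f' \<le> ereal z"
  then have "AE t \<in> {a..b} in lebesgue. \<bar>?f' t\<bar> \<le> z"
    by (intro Linf_norm_le_imp_AE) auto
  then obtain T where T: "T \<in> null_sets lebesgue" "{t. \<not> (t \<in> {a..b} \<longrightarrow> \<bar>?f' t\<bar> \<le> z)} \<subseteq> T"
    by (auto simp: eventually_ae_filter)
  \<comment> \<open>Overwriting the derivative by \<open>- z\<close> on the exceptional null set
    leaves the integral unchanged and makes the lower bound \<open>- z\<close> hold at every
    point.\<close>
  define h where "h = (\<lambda>t. if t \<in> T then - z else ?f' t)"
  have "(f has_vector_derivative ?f' t) (at t within {x..y})" if "t \<in> {x..y}" for t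
  proof -
    have "f differentiable (at t within {a..b})"
      using assms that by (auto simp: differentiable_on_def)
    then have "(f has_vector_derivative ?f' t) (at t within {a..b})"
      by (simp add: deriv_on_def vector_derivative_works)
    then show ?thesis
      by (rule has_vector_derivative_within_subset) (use assms in auto)
  qed
  then have "(?f' has_integral (f y - f x)) {x..y}"
    using assms by (intro fundamental_theorem_of_calculus) auto
  moreover have "negligible T"
    using T(1) by (simp add: negligible_iff_null_sets)
  ultimately have h: "(h has_integral (f y - f x)) {x..y}"
    by (intro has_integral_spike[of T "{x..y}" h ?f']) (auto simp: h_def)
  have const: "((\<lambda>_. - z) has_integral (y - x) *\<^sub>R (- z)) {x..y}"
    using has_integral_const_real[of "- z" x y] assms by simp
  have "- z \<le> h t" if "t \<in> {x..y}" for t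
  proof (cases "t \<in> T")
    case False
    moreover have "t \<in> {a..b}"
      using that assms by auto
    ultimately have "\<bar>?f' t\<bar> \<le> z"
      using T(2) by blast
    then show ?thesis
      using False by (simp add: h_def)
  qed (simp add: h_def)
  then have "(y - x) *\<^sub>R (- z) \<le> f y - f x"
    by (rule has_integral_le[OF const h])
  then show "ereal ((f x - f y) / (y - x)) \<le> ereal z"
    using assms(3) by (simp add: divide_le_eq mult.commute)
qed

text \<open>A point is a null set, so even the bound -\<infinity> holds almost everywhere. This
  serves to exclude a kernel of zero mass.\<close>

lemma Linf_norm_singleton:
  assumes "f \<in> borel_measurable borel"
  shows "Linf_norm {a} f = -\<infinity>"
proof -
  have "AE x in lebesgue_on {a}. ereal \<bar>f x\<bar> \<le> -\<infinity>"
    by (auto simp: AE_restrict_space_iff intro!: AE_I'[of "{a}"])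
  moreover have "(\<lambda>x. ereal \<bar>f x\<bar>) \<in> borel_measurable (lebesgue_on {a})"
    using assms by (intro measurable_restrict_space1 measurable_completion) simp
  ultimately have "Linf_norm {a} f \<le> -\<infinity>"
    unfolding Linf_norm_def by (rule esssup_I[rotated])
  then show ?thesis
    by simp
qed

text \<open>Turns an extended-real CFL bound into a real inequality. If \<open>Q\<close> is
  \<infinity>, the quotient is 0, against \<open>0 < t\<close>; the value -\<infinity> contradicts
  \<open>ereal q \<le> Q\<close>. If \<open>Q\<close> is 0, the quotient is \<infinity> and says
  nothing about \<open>t\<close>, but then \<open>q = 0\<close>.\<close>

lemma le_divide_ereal_imp_mult_le:
  assumes "ereal t \<le> ereal x / Q" "0 < t" "0 < x" "0 \<le> q" "ereal q \<le> Q"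
  shows "t * q \<le> x"
proof (cases Q)
  case (real r)
  show ?thesis
  proof (cases "r = 0")
    case True
    then show ?thesis using assms real by simp
  next
    case False
    then have "0 < r" using assms real by simp
    moreover have "t \<le> x / r" using assms(1) real False by simp
    ultimately have "t * r \<le> x" by (simp add: le_divide_eq)
    moreover have "t * q \<le> t * r"
      using assms real by (intro mult_left_mono) auto
    ultimately show ?thesis by linarith
  qed
qed (use assms in auto)

section \<open>Discrete kernel weights and their total mass\<close>

lemma kernel_weight_nonneg:
  assumes "0 < \<Delta>x" "k < N" "\<forall>y\<in>{0..real N * \<Delta>x}. \<omega> y \<ge> 0"
  shows "0 \<le> kernel_weight \<Delta>x \<omega> k"
proof -
  have "(real k + 1) * \<Delta>x \<le> real N * \<Delta>x"
    using assms by (intro mult_right_mono) auto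
  moreover have "0 \<le> real k * \<Delta>x"
    using assms by simp
  ultimately have "0 \<le> (LBINT y:{real k * \<Delta>x..(real k + 1) * \<Delta>x}. \<omega> y)"
    unfolding set_lebesgue_integral_def using assms(3)
    by (intro Bochner_Integration.integral_nonneg) (auto simp: indicator_def)
  then show ?thesis
    using assms(1) by (simp add: kernel_weight_def)
qed

lemma sum_kernel_weight:
  assumes "0 < \<Delta>x" "continuous_on {0..real N * \<Delta>x} \<omega>"
  shows "\<Delta>x * (\<Sum>k<N. kernel_weight \<Delta>x \<omega> k) = (LBINT y:{0..real N * \<Delta>x}. \<omega> y)"
  using assms(2)
proof (induction N)
  case 0
  have "(LBINT y:{0..0}. \<omega> y) = integral {0..0} \<omega>"
    by (intro set_borel_integral_eq_integral borel_integrable_atLeastAtMost') simp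
  then show ?case by simp
next
  case (Suc N)
  define a where "a = real N * \<Delta>x"
  define b where "b = (real N + 1) * \<Delta>x"
  have ab: "0 \<le> a" "a \<le> b"
    using assms(1) by (auto simp: a_def b_def algebra_simps)
  have cont: "continuous_on {0..b} \<omega>"
    using Suc.prems by (simp add: b_def add.commute)
  \<comment> \<open>For the gauge integral, adjacent closed intervals can be joined directly
    although they share an end point.\<close>
  have LB: "(LBINT y:{c..d}. \<omega> y) = integral {c..d} \<omega>" if "0 \<le> c" "d \<le> b" for c d
    by (intro set_borel_integral_eq_integral borel_integrable_atLeastAtMost'
        continuous_on_subset[OF cont]) (use that in auto)
  have "\<Delta>x * (\<Sum>k<N. kernel_weight \<Delta>x \<omega> k) = (LBINT y:{0..a}. \<omega> y)"
    unfolding a_def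
    by (rule Suc.IH, rule continuous_on_subset[OF cont]) (use ab in \<open>auto simp: a_def\<close>)
  then have "\<Delta>x * (\<Sum>k<Suc N. kernel_weight \<Delta>x \<omega> k)
      = (LBINT y:{0..a}. \<omega> y) + (LBINT y:{a..b}. \<omega> y)"
    using assms(1) by (simp add: distrib_left kernel_weight_def a_def b_def)
  also have "\<dots> = (LBINT y:{0..b}. \<omega> y)"
    using ab integrable_continuous_real[OF cont] by (simp add: LB Henstock_Kurzweil_Integration.integral_combine)
  finally show ?case
    by (simp add: b_def add.commute)
qed

text \<open>The weights are nonnegative and sum, up to the factor \<open>\<Delta>x\<close>, to the
  kernel mass. Hence velocities are evaluated only where the CFL norm of \<open>\<psi>\<close>
  controls them.\<close>

lemma nonlocal_density_in_range:
  assumes "0 < \<Delta>x" "\<eta> = real N * \<Delta>x" "continuous_on {0..\<eta>} \<omega>" "\<forall>y\<in>{0..\<eta>}. \<omega> y \<ge> 0"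
    and "\<forall>i. 0 \<le> r i \<and> r i \<le> M"
  shows "nonlocal_density \<Delta>x N \<omega> r j \<in> nonlocal_range M \<eta> \<omega>"
proof -
  have w: "0 \<le> kernel_weight \<Delta>x \<omega> k" if "k < N" for k
    using kernel_weight_nonneg assms that by simp
  have "(\<Sum>k<N. kernel_weight \<Delta>x \<omega> k * r (j + int k + 1)) \<le> (\<Sum>k<N. kernel_weight \<Delta>x \<omega> k * M)"
    using w assms(5) by (intro sum_mono mult_left_mono) auto
  also have "\<dots> = M * (\<Sum>k<N. kernel_weight \<Delta>x \<omega> k)"
    by (simp add: sum_distrib_left mult.commute)
  finally have "nonlocal_density \<Delta>x N \<omega> r j \<le> M * (\<Delta>x * (\<Sum>k<N. kernel_weight \<Delta>x \<omega> k))"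
    using assms(1) by (simp add: nonlocal_density_def mult.left_commute)
  moreover have "0 \<le> nonlocal_density \<Delta>x N \<omega> r j"
    unfolding nonlocal_density_def using w assms by (intro mult_nonneg_nonneg sum_nonneg) auto
  ultimately show ?thesis
    using sum_kernel_weight[of \<Delta>x N \<omega>] assms by (simp add: nonlocal_range_def)
qed

section \<open>One time step under CFL inequalities free of norms\<close>

lemma scheme_step_bounds:
  assumes "0 < \<Delta>t" "0 < \<Delta>x"
    and r: "\<forall>i. 0 \<le> r i \<and> r i \<le> M"
    and g: "\<forall>x\<in>{0..M}. 0 \<le> g x"
    and v: "\<forall>i. 0 \<le> face_velocity \<Delta>x N \<omega> vl vr r i"
    and cfl_g: "\<forall>i. \<forall>x\<in>{0..M}. \<Delta>t * (g x * face_velocity \<Delta>x N \<omega> vl vr r i) \<le> \<Delta>x"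
    and cfl_g': "\<forall>i. \<forall>x\<in>{0..M}. \<Delta>t * (M * g x * face_velocity \<Delta>x N \<omega> vl vr r i) \<le> \<Delta>x * (M - x)"
  shows "0 \<le> scheme_step \<Delta>t \<Delta>x N \<omega> g vl vr r j \<and> scheme_step \<Delta>t \<Delta>x N \<omega> g vl vr r j \<le> M"
proof
  let ?V = "face_velocity \<Delta>x N \<omega> vl vr r"
  have step: "scheme_step \<Delta>t \<Delta>x N \<omega> g vl vr r j
      = r j - \<Delta>t * (r j * g (r (j + 1)) * ?V j) / \<Delta>x + \<Delta>t * (r (j - 1) * g (r j) * ?V (j - 1)) / \<Delta>x"
    by (simp add: scheme_step_def algebra_simps diff_divide_distrib)
  \<comment> \<open>This is the scaled flux through the left face of cell \<open>i\<close>: for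
    \<open>i = j\<close> the inflow of cell \<open>j\<close>, for \<open>i = j + 1\<close> its
    outflow.\<close>
  have flux: "0 \<le> \<Delta>t * (r (i - 1) * g (r i) * ?V (i - 1)) / \<Delta>x" for i
    using assms(1,2) r g v by (intro divide_nonneg_pos mult_nonneg_nonneg) auto
  have "\<Delta>t * (g (r (j + 1)) * ?V j) \<le> \<Delta>x"
    using cfl_g r by simp
  then have "r j * (\<Delta>t * (g (r (j + 1)) * ?V j)) \<le> r j * \<Delta>x"
    using r by (intro mult_left_mono) auto
  then have "\<Delta>t * (r j * g (r (j + 1)) * ?V j) / \<Delta>x \<le> r j"
    using assms(2) by (simp add: divide_le_eq algebra_simps)
  then show "0 \<le> scheme_step \<Delta>t \<Delta>x N \<omega> g vl vr r j"
    using flux[of j] by (simp add: step)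
  have "\<Delta>t * (r (j - 1) * g (r j) * ?V (j - 1)) \<le> \<Delta>t * (M * g (r j) * ?V (j - 1))"
    using assms(1) r g v by (intro mult_left_mono mult_right_mono) auto
  also have "\<dots> \<le> \<Delta>x * (M - r j)"
    using cfl_g' r by simp
  finally have "\<Delta>t * (r (j - 1) * g (r j) * ?V (j - 1)) / \<Delta>x \<le> M - r j"
    using assms(2) by (simp add: divide_le_eq mult.commute)
  then show "scheme_step \<Delta>t \<Delta>x N \<omega> g vl vr r j \<le> M"
    using flux[of "j + 1"] by (simp add: step)
qed

theorem lemma3p1:
  fixes \<rho>max kl kr \<eta> \<Delta>x \<Delta>t :: real
    and N :: nat
    and g \<psi> vl vr \<omega> \<rho>0 :: "real \<Rightarrow> real"
    and \<rho> :: "nat \<Rightarrow> int \<Rightarrow> real"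
  assumes rhomax_pos: "\<rho>max > 0"
    and g_diff: "g differentiable_on {0..\<rho>max}"
    and g_pos: "\<forall>r\<in>{0..<\<rho>max}. g r > 0"
    and g_antimono: "\<forall>r\<in>{0..\<rho>max}. deriv_on {0..\<rho>max} g r \<le> 0"
    and g_rhomax: "g \<rho>max = 0"
    and k_pos: "kl > 0" "kr > 0"
    and eta_pos: "\<eta> > 0"
    and kernel_C2: "C2_on {0..\<eta>} \<omega>"
    and kernel_nonneg: "\<forall>y\<in>{0..\<eta>}. \<omega> y \<ge> 0"
    and kernel_antimono: "\<forall>y\<in>{0..\<eta>}. deriv_on {0..\<eta>} \<omega> y \<le> 0"
    and kernel_end: "\<omega> \<eta> = 0"
    and vl: "\<forall>r. vl r = kl * \<psi> r"
    and vr: "\<forall>r. vr r = kr * \<psi> r"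
    and psi_C2: "C2_on UNIV \<psi>"
    and psi_antimono: "\<forall>r. deriv_on UNIV \<psi> r \<le> 0"
    and psi_nonneg: "\<forall>r\<in>nonlocal_range \<rho>max \<eta> \<omega>. \<psi> r \<ge> 0"
    and mesh: "\<Delta>x > 0" "\<Delta>t > 0" "\<eta> = real N * \<Delta>x"
    and rho0_loc_integrable: "\<forall>a b. set_integrable lborel {a..b} \<rho>0"
    and scheme_init: "\<forall>j. \<rho> 0 j = cell_average \<Delta>x \<rho>0 j"
    and scheme_step: "\<forall>n j. \<rho> (Suc n) j = scheme_step \<Delta>t \<Delta>x N \<omega> g vl vr (\<rho> n) j"
    and init_bounds: "\<forall>j. 0 \<le> \<rho> 0 j \<and> \<rho> 0 j \<le> \<rho>max"
    and CFL: "ereal \<Delta>t \<le> (MIN k\<in>{kl, kr}. min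
        (ereal \<Delta>x / (ereal \<rho>max * ereal k * Linf_norm {0..\<rho>max} (deriv_on {0..\<rho>max} g)
                      * Linf_norm (nonlocal_range \<rho>max \<eta> \<omega>) \<psi>))
        (ereal \<Delta>x / (ereal k * Linf_norm {0..\<rho>max} g
                      * Linf_norm (nonlocal_range \<rho>max \<eta> \<omega>) \<psi>)))"
  shows "\<forall>n j. 0 \<le> \<rho> (Suc n) j \<and> \<rho> (Suc n) j \<le> \<rho>max"
proof -
  define K where "K = nonlocal_range \<rho>max \<eta> \<omega>"
  define P where "P = Linf_norm K \<psi>"
  define G where "G = Linf_norm {0..\<rho>max} g"
  define D where "D = Linf_norm {0..\<rho>max} (deriv_on {0..\<rho>max} g)"
  have CFL_D: "ereal \<Delta>t \<le> ereal \<Delta>x / (ereal \<rho>max * ereal k * D * P)"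
    and CFL_G: "ereal \<Delta>t \<le> ereal \<Delta>x / (ereal k * G * P)" if "k \<in> {kl, kr}" for k
    using CFL that by (auto simp: K_def P_def G_def D_def)
  have k0: "0 < k" if "k \<in> {kl, kr}" for k
    using that k_pos by auto
  have g_nonneg: "\<forall>x\<in>{0..\<rho>max}. 0 \<le> g x"
    using g_pos g_rhomax by (metis atLeastAtMost_iff atLeastLessThan_iff less_eq_real_def)
  have G: "ereal (g x) \<le> G" if "x \<in> {0..\<rho>max}" for x
    using abs_le_Linf_norm[OF rhomax_pos differentiable_imp_continuous_on[OF g_diff] that] g_nonneg that
    by (simp add: G_def)
  \<comment> \<open>Since \<open>g \<rho>max = 0\<close>, this is the rate of decrease of
    \<open>g\<close> between \<open>x\<close> and \<open>\<rho>max\<close>.\<close>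
  have D: "ereal (g x / (\<rho>max - x)) \<le> D" if "x \<in> {0..<\<rho>max}" for x
    using difference_quotient_le_Linf_norm_deriv[OF g_diff, of x \<rho>max] that g_rhomax by (simp add: D_def)
  have \<omega>_cont: "continuous_on {0..\<eta>} \<omega>"
    using kernel_C2 by (auto simp: C2_on_def intro: differentiable_imp_continuous_on)
  have \<psi>_cont: "continuous_on UNIV \<psi>"
    using psi_C2 by (auto simp: C2_on_def intro: differentiable_imp_continuous_on)
  \<comment> \<open>\<open>K\<close> is the interval from 0 to \<open>\<rho>max * mass\<close>. It
    must have positive length before \<open>P\<close> can bound \<open>\<psi>\<close>
    pointwise.\<close>
  define mass where "mass = (LBINT y:{0..\<eta>}. \<omega> y)"
  have "0 \<le> mass"
    unfolding mass_def set_lebesgue_integral_def using kernel_nonneg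
    by (intro Bochner_Integration.integral_nonneg) (auto simp: indicator_def)
  moreover have "mass \<noteq> 0"
  \<comment> \<open>For a vanishing kernel \<open>K\<close> is a null set, so \<open>P = -\<infinity>\<close> and the CFL condition reads \<open>\<Delta>t \<le> 0\<close>.\<close>
  proof
    assume "mass = 0"
    then have "P = -\<infinity>"
      using Linf_norm_singleton[of \<psi> 0] \<psi>_cont
      by (simp add: P_def K_def nonlocal_range_def mass_def borel_measurable_continuous_onI)
    \<comment> \<open>With \<open>G = 0\<close> the product with \<open>P\<close> would be 0 rather
      than -\<infinity>, and the bound on \<open>\<Delta>t\<close> would be \<infinity>.\<close>
    moreover have "0 < G"
      using G[of 0] g_pos rhomax_pos by (auto intro: less_le_trans[of 0 "ereal (g 0)"])
    then have "0 < ereal kl * G"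
      using k_pos by (simp add: ereal_zero_less_0_iff)
    ultimately show False
      using CFL_G[of kl] mesh(2) by (cases "ereal kl * G") auto
  qed
  ultimately have "0 < mass" by simp
  have P: "ereal (\<psi> x) \<le> P" if "x \<in> K" for x
  proof -
    have "ereal \<bar>\<psi> x\<bar> \<le> P"
      using abs_le_Linf_norm[of 0 "\<rho>max * mass" \<psi> x] \<open>0 < mass\<close> rhomax_pos that
        continuous_on_subset[OF \<psi>_cont]
      by (simp add: P_def K_def nonlocal_range_def mass_def)
    then show ?thesis
      using psi_nonneg that by (simp add: K_def)
  qed
  \<comment> \<open>This and \<open>cfl_g'\<close> are the norm-free inequalities that
    \<open>scheme_step_bounds\<close> takes. All real factors are nonnegative, so replacing them by
    norms is monotone in the extended reals.\<close>
  have cfl_g: "\<Delta>t * (g x * (k * \<psi> R)) \<le> \<Delta>x"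
    if "k \<in> {kl, kr}" "x \<in> {0..\<rho>max}" "R \<in> K" for k x R
  proof -
    have "0 \<le> g x" "0 \<le> \<psi> R" using that g_nonneg psi_nonneg by (auto simp: K_def)
    have "ereal k * ereal (g x) * ereal (\<psi> R) \<le> ereal k * G * P"
      using k0[OF that(1)] \<open>0 \<le> g x\<close> \<open>0 \<le> \<psi> R\<close> G[OF that(2)] P[OF that(3)]
      by (intro ereal_mult_mono') auto
    then have "\<Delta>t * (k * g x * \<psi> R) \<le> \<Delta>x"
      using k0[OF that(1)] \<open>0 \<le> g x\<close> \<open>0 \<le> \<psi> R\<close> mesh
      by (intro le_divide_ereal_imp_mult_le[OF CFL_G[OF that(1)]]) auto
    then show ?thesis by (simp add: algebra_simps)
  qed
  have cfl_g': "\<Delta>t * (\<rho>max * g x * (k * \<psi> R)) \<le> \<Delta>x * (\<rho>max - x)"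
    if "k \<in> {kl, kr}" "x \<in> {0..\<rho>max}" "R \<in> K" for k x R
  proof (cases "x = \<rho>max")
    case True
    then show ?thesis using g_rhomax by simp
  next
    case False
    then have x: "x \<in> {0..<\<rho>max}" using that by auto
    \<comment> \<open>The first CFL bound is applied to the secant slope \<open>q\<close>;
      multiplying by \<open>\<rho>max - x\<close> then recovers \<open>g x\<close>.\<close>
    define q where "q = g x / (\<rho>max - x)"
    have "0 \<le> q" "0 \<le> \<psi> R"
      using that x g_nonneg psi_nonneg by (auto simp: K_def q_def)
    have "ereal \<rho>max * ereal k * ereal q * ereal (\<psi> R) \<le> ereal \<rho>max * ereal k * D * P"
      using k0[OF that(1)] rhomax_pos \<open>0 \<le> q\<close> \<open>0 \<le> \<psi> R\<close> D[OF x, folded q_def] P[OF that(3)]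
      by (intro ereal_mult_mono') auto
    then have "\<Delta>t * (\<rho>max * k * q * \<psi> R) \<le> \<Delta>x"
      using k0[OF that(1)] rhomax_pos \<open>0 \<le> q\<close> \<open>0 \<le> \<psi> R\<close> mesh
      by (intro le_divide_ereal_imp_mult_le[OF CFL_D[OF that(1)]]) auto
    then have "\<Delta>t * (\<rho>max * k * q * \<psi> R) * (\<rho>max - x) \<le> \<Delta>x * (\<rho>max - x)"
      using x by (intro mult_right_mono) auto
    moreover have "g x = q * (\<rho>max - x)"
      using x by (simp add: q_def)
    then have "\<Delta>t * (\<rho>max * k * q * \<psi> R) * (\<rho>max - x) = \<Delta>t * (\<rho>max * g x * (k * \<psi> R))"
      by (simp only: mult_ac)
    ultimately show ?thesis by simp
  qed
  have bounds: "\<forall>j. 0 \<le> \<rho> n j \<and> \<rho> n j \<le> \<rho>max" for n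
  proof (induction n)
    case 0
    show ?case using init_bounds .
  next
    case (Suc n)
    \<comment> \<open>Faces on both sides of the interface have velocities of this one form, so no
      later step distinguishes \<open>vl\<close> from \<open>vr\<close>.\<close>
    have V: "\<exists>k R. k \<in> {kl, kr} \<and> R \<in> K \<and> face_velocity \<Delta>x N \<omega> vl vr (\<rho> n) i = k * \<psi> R" for i
      using nonlocal_density_in_range[OF mesh(1,3) \<omega>_cont kernel_nonneg Suc.IH, of i] vl vr
      by (auto simp: face_velocity_def K_def)
    have "0 \<le> scheme_step \<Delta>t \<Delta>x N \<omega> g vl vr (\<rho> n) j
        \<and> scheme_step \<Delta>t \<Delta>x N \<omega> g vl vr (\<rho> n) j \<le> \<rho>max" for j
    proof (rule scheme_step_bounds[OF mesh(2,1) Suc.IH g_nonneg]; intro allI ballI)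
      show "0 \<le> face_velocity \<Delta>x N \<omega> vl vr (\<rho> n) i" for i
        using V[of i] k0 psi_nonneg by (metis K_def less_imp_le mult_nonneg_nonneg)
      show "\<Delta>t * (g x * face_velocity \<Delta>x N \<omega> vl vr (\<rho> n) i) \<le> \<Delta>x" if "x \<in> {0..\<rho>max}" for i x
        using V[of i] cfl_g that by metis
      show "\<Delta>t * (\<rho>max * g x * face_velocity \<Delta>x N \<omega> vl vr (\<rho> n) i) \<le> \<Delta>x * (\<rho>max - x)"
        if "x \<in> {0..\<rho>max}" for i x
        using V[of i] cfl_g' that by metis
    qed
    then show ?case using scheme_step by simp
  qed
  then show ?thesis by blast
qed

end
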